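(* For any $\epsilon_1>0$, one can choose an integer $k>0$ such that $$\max\left(\frac1k,\ \sum_{j=k}^{+\infty}\frac1{j^2}\right)<\epsilon_1 .$$ Then, for any unit pseudo-eigenvector $\mathbf{v}^{(N)}$ ($\|\mathbf{v}^{(N)}\|_2=1$) of $\mathcal{C}^\gamma_{N,k}$ satisfying $$\left\|\left(\mathcal{C}^\gamma_{N,k}-\lambda I\right)\mathbf{v}^{(N)}\right\|_2\le\epsilon_2$$ and $$\frac{\left|(\mathbf{v}^{(N)})_j\right|}{\max_{j}\left|(\mathbf{v}^{(N)})_j\right|}\le C\rho^{j-1},\ j=1,\dots,N,\qquad\text{or}\qquad \frac{\left|(\mathbf{v}^{(N)})_j\right|}{\max_{j}\left|(\mathbf{v}^{(N)})_j\right|}\le C\rho^{N-j},\ j=1,\dots,N,$$ for some constant $C$ and $0<\rho<1-\epsilon_1$, one has $$\left\|\left(\mathcal{C}^\gamma_N-\lambda I\right)\mathbf{v}^{(N)}\right\|_2\le\epsilon_2+\delta KC\left(\frac{1-\epsilon_1}{1-\epsilon_1-\rho}\sqrt{\epsilon_1}+\epsilon_1\rho^k\frac1{1-\rho}\sqrt{\frac1{1-\rho^2}}\right).$$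
   Context: Geometry: $D\subset[0,1)\times\mathbb{R}^2$ is a simply connected bounded domain of class $C^{1,s}$, $0<s<1$; $D_i=D+(i,0,0)^\top$ (pairwise disjoint closures), $\mathcal{D}_N=\bigcup_{i=1}^ND_i$; $\gamma\in\mathbb{R}\setminus\{0\}$ and $\delta>0$ are fixed. Gauge capacitance matrix: with $\mathcal{S}^0_{\mathcal{D}_N}[\phi](x)=-\int_{\partial\mathcal{D}_N}\frac{\phi(y)}{4\pi|x-y|}\,\mathrm{d}\sigma(y)$ (an invertible operator $L^2(\partial\mathcal{D}_N)\to H^1(\partial\mathcal{D}_N)$), $$(\mathcal{C}_N^\gamma)_{i,j}=-\frac{\delta}{\int_{D_i}e^{\gamma x_1}\,\mathrm{d}x}\int_{\partial D_i}e^{\gamma x_1}(\mathcal{S}^0_{\mathcal{D}_N})^{-1}[\chi_{\partial D_j}]\,\mathrm{d}\sigma,\qquad 1\le i,j\le N,$$ where $\chi$ denotes an indicator function. Its $k$-banded version is $(\mathcal{C}^\gamma_{N,k})_{i,j}=(\mathcal{C}^\gamma_N)_{i,j}$ if $|i-j|<k$, and $0$ if $|i-j|\ge k$. The constant $K$ is a constant, independent of $N$, for which $|(\mathcal{C}^\gamma_N)_{i,j}|\le\frac{\delta K}{|i-j|}$ for all $i\ne j$. Here $\lambda\in\mathbb{C}$, $\epsilon_2>0$, and $I$ is the identity matrix. *)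

theory Defs
  imports "HOL-Analysis.Analysis" "Jordan_Normal_Form.Matrix"
begin

no_notation vec_index (infixl "$" 100)

definition holder_C1_on :: "real \<Rightarrow> (real^2) set \<Rightarrow> (real^2 \<Rightarrow> real) \<Rightarrow> bool" where
  "holder_C1_on s U g \<longleftrightarrow>
     (\<exists>(g' :: real^2 \<Rightarrow> real^2) L.
        (\<forall>y\<in>U. (g has_derivative (\<lambda>h. g' y \<bullet> h)) (at y)) \<and>
        (\<forall>y\<in>U. \<forall>z\<in>U. norm (g' y - g' z) \<le> L * norm (y - z) powr s))"

text \<open>
  Near each boundary point, and after an orthogonal change of coordinates \<open>T\<close>, a set with
  \<open>C\<close>-\<open>(1,s)\<close> boundary is the strict epigraph of a \<open>C\<close>-\<open>(1,s)\<close> function of the first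
  two coordinates.
\<close>

definition holder_C1_boundary :: "real \<Rightarrow> (real^3) set \<Rightarrow> bool" where
  "holder_C1_boundary s D \<longleftrightarrow>
     (\<forall>p\<in>frontier D. \<exists>r>0. \<exists>(T :: real^3 \<Rightarrow> real^3) g. orthogonal_transformation T \<and>
        (let q = (\<lambda>x. vector [T x $ 1, T x $ 2] :: real^2) in
           holder_C1_on s (ball (q p) r) g \<and>
           D \<inter> ball p r = {x \<in> ball p r. g (q x) < T x $ 3}))"

definition resonator :: "(real^3) set \<Rightarrow> nat \<Rightarrow> (real^3) set" where
  "resonator D i = (\<lambda>x. x + vector [real i, 0, 0]) ` D"

definition resonators :: "(real^3) set \<Rightarrow> nat \<Rightarrow> (real^3) set" where
  "resonators D N = (\<Union>i\<in>{1..N}. resonator D i)"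

definition admissible_resonator :: "real \<Rightarrow> (real^3) set \<Rightarrow> bool" where
  "admissible_resonator s D \<longleftrightarrow>
     D \<noteq> {} \<and> open D \<and> connected D \<and> simply_connected D \<and> bounded D \<and>
     holder_C1_boundary s D \<and>
     D \<subseteq> {x. 0 \<le> x $ 1 \<and> x $ 1 < 1} \<and>
     (\<forall>i j. i \<noteq> j \<longrightarrow> closure (resonator D i) \<inter> closure (resonator D j) = {})"

text \<open>
  The surface measure is the two-dimensional Hausdorff measure on the Borel sets. The factor
  \<open>pi / 4\<close> is the area of a disc of diameter 1, so that the measure is the usual area on
  \<open>C1\<close> surfaces. The sets are required to be bounded because \<open>diameter\<close> is real-valued.
\<close>

definition hausdorff2_premeasure :: "real \<Rightarrow> (real^3) set \<Rightarrow> ennreal" where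
  "hausdorff2_premeasure \<eta> A =
     (INF U \<in> {U :: nat \<Rightarrow> (real^3) set.
                 A \<subseteq> (\<Union>n. U n) \<and> (\<forall>n. bounded (U n) \<and> diameter (U n) \<le> \<eta>)}.
        (\<Sum>n. ennreal (pi / 4 * (diameter (U n))\<^sup>2)))"

definition hausdorff2 :: "(real^3) set \<Rightarrow> ennreal" where
  "hausdorff2 A = (SUP \<eta>\<in>{0<..}. hausdorff2_premeasure \<eta> A)"

definition surface_measure :: "(real^3) measure" where
  "surface_measure = measure_of UNIV (sets borel) hausdorff2"

definition square_integrable_on :: "(real^3) set \<Rightarrow> (real^3 \<Rightarrow> real) set" where
  "square_integrable_on S =
     {\<phi>. set_borel_measurable surface_measure S \<phi> \<and>
          set_integrable surface_measure S (\<lambda>x. (\<phi> x)\<^sup>2)}"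

definition single_layer :: "(real^3) set \<Rightarrow> (real^3 \<Rightarrow> real) \<Rightarrow> real^3 \<Rightarrow> real" where
  "single_layer \<Omega> \<phi> x =
     - (LINT y:frontier \<Omega>|surface_measure. \<phi> y / (4 * pi * norm (x - y)))"

text \<open>
  Elements of \<open>L2\<close> are represented by functions, so the preimage of \<open>f\<close> under the (invertible)
  single layer operator is determined up to a null set of the boundary; the integrals below do
  not depend on the representative chosen.
\<close>

definition single_layer_inv :: "(real^3) set \<Rightarrow> (real^3 \<Rightarrow> real) \<Rightarrow> real^3 \<Rightarrow> real" where
  "single_layer_inv \<Omega> f =
     (SOME \<phi>. \<phi> \<in> square_integrable_on (frontier \<Omega>) \<and>
        (AE x in surface_measure. x \<in> frontier \<Omega> \<longrightarrow> single_layer \<Omega> \<phi> x = f x))"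

definition gauge_capacitance_entry ::
  "(real^3) set \<Rightarrow> real \<Rightarrow> real \<Rightarrow> nat \<Rightarrow> nat \<Rightarrow> nat \<Rightarrow> real" where
  "gauge_capacitance_entry D \<gamma> \<delta> N i j =
     - (\<delta> / (LINT x:resonator D i|lborel. exp (\<gamma> * x $ 1))) *
       (LINT x:frontier (resonator D i)|surface_measure.
          exp (\<gamma> * x $ 1) *
          single_layer_inv (resonators D N) (indicator (frontier (resonator D j))) x)"

text \<open>
  Matrices and vectors are indexed from \<open>0\<close>, resonators from \<open>1\<close>.
\<close>

definition gauge_capacitance :: "(real^3) set \<Rightarrow> real \<Rightarrow> real \<Rightarrow> nat \<Rightarrow> real mat" where
  "gauge_capacitance D \<gamma> \<delta> N =
     mat N N (\<lambda>(i, j). gauge_capacitance_entry D \<gamma> \<delta> N (Suc i) (Suc j))"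

definition banded :: "nat \<Rightarrow> real mat \<Rightarrow> real mat" where
  "banded k A =
     mat (dim_row A) (dim_col A)
       (\<lambda>(i, j). if \<bar>int i - int j\<bar> < int k then A $$ (i, j) else 0)"

definition vec_norm2 :: "complex Matrix.vec \<Rightarrow> real" where
  "vec_norm2 v = L2_set (\<lambda>i. cmod (vec_index v i)) {..<dim_vec v}"

definition vec_max :: "complex Matrix.vec \<Rightarrow> real" where
  "vec_max v = Max ((\<lambda>i. cmod (vec_index v i)) ` {..<dim_vec v})"

text \<open>
  From here on \<open>$\<close> is the entry of a matrix-library vector.
\<close>

no_notation vec_nth (infixl "$" 90)
notation vec_index (infixl "$" 100)

end

theory Submission
  imports Defs
begin

text \<open>
  The error made by banding is the far-field part of the matrix, with entries of size at most
  \<open>\<delta>K / |i - j|\<close> for \<open>|i - j| \<ge> k\<close>, applied to an exponentially decaying vector. The part below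
  the diagonal is a convolution of \<open>\<rho>^j\<close> with the tail of \<open>1 / m\<close>, so Young's inequality
  \<open>l1 * l2 \<subseteq> l2\<close> bounds it by \<open>sqrt \<epsilon> / (1 - \<rho>)\<close>; above the diagonal \<open>1 / |i - j| \<le> 1 / k\<close> and the
  geometric series remain. Decay from the right end reduces to decay from the left end by
  reversing the order of the indices.
\<close>

section \<open>Tails of the inverse square series\<close>

lemma summable_inverse_squares_shift: "summable (\<lambda>n. 1 / (real (k + n))\<^sup>2)"
proof -
  have "summable (\<lambda>n. inverse (real n ^ 2))"
    by (rule inverse_power_summable) simp
  then have "summable (\<lambda>n. inverse (real (n + k) ^ 2))"
    by (rule summable_ignore_initial_segment)
  then show ?thesis
    by (simp add: inverse_eq_divide add.commute)
qed

lemma inverse_squares_tail_nonneg: "0 \<le> (\<Sum>n. 1 / (real (k + n))\<^sup>2)"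
  by (intro suminf_nonneg summable_inverse_squares_shift) simp

lemma inverse_squares_tail_tendsto_0: "(\<lambda>k. \<Sum>n. 1 / (real (k + n))\<^sup>2) \<longlonglongrightarrow> 0"
proof (rule LIMSEQ_I)
  fix r :: real
  assume "0 < r"
  \<comment> \<open>With shift 0 the term \<open>n = 0\<close> is \<open>1 / 0 = 0\<close>, so this
    is the full inverse square series; its remainder from index \<open>k\<close> on is the sum in
    question.\<close>
  from suminf_exist_split[OF this summable_inverse_squares_shift[of 0]]
  show "\<exists>M. \<forall>k\<ge>M. norm ((\<Sum>n. 1 / (real (k + n))\<^sup>2) - 0) < r"
    by (simp add: add.commute)
qed

lemma exists_small_tail:
  fixes \<epsilon> :: real
  assumes "\<epsilon> > 0"
  shows "\<exists>k::nat. k > 0 \<and> max (1 / real k) (\<Sum>n. 1 / (real (k + n))\<^sup>2) < \<epsilon>"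
proof -
  have "eventually (\<lambda>k. (\<Sum>n. 1 / (real (k + n))\<^sup>2) < \<epsilon>) sequentially"
    using order_tendstoD(2)[OF inverse_squares_tail_tendsto_0 assms] .
  moreover have "eventually (\<lambda>k. 1 / real k < \<epsilon>) sequentially"
    using order_tendstoD(2)[OF lim_1_over_n assms] .
  ultimately have "eventually (\<lambda>k. k > 0 \<and> max (1 / real k) (\<Sum>n. 1 / (real (k + n))\<^sup>2) < \<epsilon>) sequentially"
    using eventually_gt_at_top[of 0] by eventually_elim simp
  then show ?thesis
    by (rule eventually_happens'[OF sequentially_bot])
qed

section \<open>Far-field sums of an exponentially decaying sequence\<close>

lemma L2_set_sum_le:
  assumes "finite J"
  shows "L2_set (\<lambda>i. \<Sum>j\<in>J. f i j) I \<le> (\<Sum>j\<in>J. L2_set (\<lambda>i. f i j) I)"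
  using assms
proof (induction J)
  case empty
  then show ?case by (simp add: L2_set_def)
next
  case (insert j J)
  then show ?case
    using L2_set_triangle_ineq[of "\<lambda>i. f i j" "\<lambda>i. \<Sum>j\<in>J. f i j" I] by simp
qed

lemma sum_power_le:
  fixes x :: real
  assumes "0 \<le> x" "x < 1" "finite I"
  shows "(\<Sum>i\<in>I. x ^ i) \<le> 1 / (1 - x)"
  using sum_le_suminf[of "\<lambda>i. x ^ i" I] suminf_geometric[of x] assms
  by (simp add: summable_geometric)

text \<open>Substituting \<open>i = j + k + n\<close> turns the squared entries of column
  \<open>j\<close> into \<open>1 / (k + n)^2\<close>. The resulting bound is the same for every
  column and every \<open>N\<close>, so it can later be pulled out of a sum over
  \<open>j\<close>.\<close>

lemma L2_set_inverse_distance_le: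
  "L2_set (\<lambda>i. if j + k \<le> i then 1 / \<bar>real i - real j\<bar> else 0) {..<N}
     \<le> sqrt (\<Sum>n. 1 / (real (k + n))\<^sup>2)"
proof -
  have "(\<Sum>i<N. (if j + k \<le> i then 1 / \<bar>real i - real j\<bar> else 0)\<^sup>2)
      = (\<Sum>i\<in>{j + k..<N}. 1 / (real i - real j)\<^sup>2)"
    by (rule sum.mono_neutral_cong_right) (auto simp: power_divide)
  also have "\<dots> = (\<Sum>n<N - (j + k). 1 / (real (k + n))\<^sup>2)"
    by (rule sum.reindex_bij_witness[of _ "\<lambda>n. n + (j + k)" "\<lambda>i. i - (j + k)"])
       (auto simp: of_nat_diff)
  also have "\<dots> \<le> (\<Sum>n. 1 / (real (k + n))\<^sup>2)"
    by (rule sum_le_suminf[OF summable_inverse_squares_shift]) auto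
  finally show ?thesis
    unfolding L2_set_def by simp
qed

lemma L2_set_far_field_le:
  fixes \<rho> :: real
  assumes k: "k > 0" and \<rho>: "0 < \<rho>" "\<rho> < 1"
  shows "L2_set (\<lambda>i. \<Sum>j<N. if int k \<le> \<bar>int i - int j\<bar> then \<rho> ^ j / \<bar>real i - real j\<bar> else 0) {..<N}
    \<le> 1 / (1 - \<rho>) * sqrt (\<Sum>n. 1 / (real (k + n))\<^sup>2)
       + 1 / real k * \<rho> ^ k * (1 / (1 - \<rho>)) * sqrt (1 / (1 - \<rho>\<^sup>2))"
proof -
  define a where "a i j = (if j + k \<le> i then 1 / \<bar>real i - real j\<bar> else 0)" for i j
  define b where "b i j = (if i + k \<le> j then \<rho> ^ j / \<bar>real i - real j\<bar> else 0)" for i j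
  have \<rho>2: "0 \<le> \<rho>\<^sup>2" "\<rho>\<^sup>2 < 1"
    using \<rho> by (auto simp: power_less_one_iff)
  \<comment> \<open>The far field splits into the parts below and above the diagonal. Because
    \<open>k > 0\<close>, the conditions \<open>j + k \<le> i\<close> and
    \<open>i + k \<le> j\<close> exclude each other, so no entry is counted twice. The weight stays
    outside \<open>a\<close> but is built into \<open>b\<close>.\<close>
  have split: "(\<Sum>j<N. if int k \<le> \<bar>int i - int j\<bar> then \<rho> ^ j / \<bar>real i - real j\<bar> else 0)
      = (\<Sum>j<N. \<rho> ^ j * a i j) + (\<Sum>j<N. b i j)" for i
    unfolding sum.distrib[symmetric] a_def b_def
    using k by (intro sum.cong) auto
  have lower: "L2_set (\<lambda>i. \<Sum>j<N. \<rho> ^ j * a i j) {..<N}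
      \<le> 1 / (1 - \<rho>) * sqrt (\<Sum>n. 1 / (real (k + n))\<^sup>2)"
  proof -
    \<comment> \<open>Young's inequality in the form of Minkowski's: the norm of a sum of columns is
      at most the sum of the column norms, here a uniform bound times the geometric weights.\<close>
    have "L2_set (\<lambda>i. \<Sum>j<N. \<rho> ^ j * a i j) {..<N} \<le> (\<Sum>j<N. L2_set (\<lambda>i. \<rho> ^ j * a i j) {..<N})"
      by (rule L2_set_sum_le) simp
    also have "\<dots> = (\<Sum>j<N. \<rho> ^ j * L2_set (\<lambda>i. a i j) {..<N})"
      using \<rho> by (simp add: L2_set_right_distrib)
    also have "\<dots> \<le> (\<Sum>j<N. \<rho> ^ j * sqrt (\<Sum>n. 1 / (real (k + n))\<^sup>2))"
      unfolding a_def using \<rho> by (intro sum_mono mult_left_mono L2_set_inverse_distance_le) auto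
    also have "\<dots> = (\<Sum>j<N. \<rho> ^ j) * sqrt (\<Sum>n. 1 / (real (k + n))\<^sup>2)"
      by (simp add: sum_distrib_right)
    also have "\<dots> \<le> 1 / (1 - \<rho>) * sqrt (\<Sum>n. 1 / (real (k + n))\<^sup>2)"
      using \<rho> by (intro mult_right_mono sum_power_le)
        (auto simp only: real_sqrt_ge_zero inverse_squares_tail_nonneg finite_lessThan less_imp_le)
    finally show ?thesis .
  qed
  define c where "c = 1 / real k * \<rho> ^ k * (1 / (1 - \<rho>))"
  have c: "0 \<le> c"
    using \<rho> unfolding c_def by simp
  \<comment> \<open>Write \<open>j = i + k + n\<close>. Then \<open>\<rho> ^ j\<close> factors as
    \<open>\<rho> ^ k * \<rho> ^ i * \<rho> ^ n\<close>: the sum over \<open>n\<close> is geometric,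
    and the surviving factor \<open>\<rho> ^ i\<close> makes the rows square summable, with a
    geometric series of ratio \<open>\<rho>\<^sup>2\<close>.\<close>
  have row: "(\<Sum>j<N. b i j) \<le> c * \<rho> ^ i" for i
  proof -
    have "(\<Sum>j<N. b i j) \<le> (\<Sum>j\<in>{i + k..<N}. \<rho> ^ j * (1 / real k))"
    proof -
      have "(\<Sum>j<N. b i j) = (\<Sum>j\<in>{i + k..<N}. \<rho> ^ j / \<bar>real i - real j\<bar>)"
        unfolding b_def by (rule sum.mono_neutral_cong_right) auto
      also have "\<dots> \<le> (\<Sum>j\<in>{i + k..<N}. \<rho> ^ j * (1 / real k))"
        using k \<rho> by (intro sum_mono) (auto intro!: divide_left_mono)
      finally show ?thesis .
    qed
    also have "\<dots> = (\<Sum>n<N - (i + k). (1 / real k * \<rho> ^ k * \<rho> ^ i) * \<rho> ^ n)"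
      by (rule sum.reindex_bij_witness[of _ "\<lambda>n. n + (i + k)" "\<lambda>j. j - (i + k)"])
         (auto simp flip: power_add)
    also have "\<dots> = (1 / real k * \<rho> ^ k * \<rho> ^ i) * (\<Sum>n<N - (i + k). \<rho> ^ n)"
      by (simp add: sum_distrib_left)
    also have "\<dots> \<le> (1 / real k * \<rho> ^ k * \<rho> ^ i) * (1 / (1 - \<rho>))"
      using \<rho> by (intro mult_left_mono sum_power_le) auto
    finally show ?thesis
      unfolding c_def by (simp add: mult_ac)
  qed
  have "L2_set (\<lambda>i. \<Sum>j<N. b i j) {..<N} \<le> L2_set (\<lambda>i. c * \<rho> ^ i) {..<N}"
    using \<rho> by (intro L2_set_mono row sum_nonneg) (auto simp: b_def)
  also have "\<dots> = c * L2_set (\<lambda>i. \<rho> ^ i) {..<N}"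
    using c by (simp add: L2_set_right_distrib)
  also have "\<dots> = c * sqrt (\<Sum>i<N. (\<rho>\<^sup>2) ^ i)"
    by (simp add: L2_set_def power_mult[symmetric] mult.commute)
  also have "\<dots> \<le> c * sqrt (1 / (1 - \<rho>\<^sup>2))"
    using c sum_power_le[OF \<rho>2] by (intro mult_left_mono real_sqrt_le_mono) auto
  finally have upper: "L2_set (\<lambda>i. \<Sum>j<N. b i j) {..<N} \<le> c * sqrt (1 / (1 - \<rho>\<^sup>2))" .
  show ?thesis
    unfolding split
    using L2_set_triangle_ineq[of "\<lambda>i. \<Sum>j<N. \<rho> ^ j * a i j" "\<lambda>i. \<Sum>j<N. b i j" "{..<N}"] lower upper
    unfolding c_def by linarith
qed

text \<open>The reflection \<open>i \<mapsto> N - Suc i\<close>, applied to rows and columns at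
  once, preserves all distances and exchanges the two weights.\<close>

lemma L2_set_far_field_reverse:
  fixes \<rho> :: real
  shows "L2_set (\<lambda>i. \<Sum>j<N. if int k \<le> \<bar>int i - int j\<bar> then \<rho> ^ (N - Suc j) / \<bar>real i - real j\<bar> else 0) {..<N}
    = L2_set (\<lambda>i. \<Sum>j<N. if int k \<le> \<bar>int i - int j\<bar> then \<rho> ^ j / \<bar>real i - real j\<bar> else 0) {..<N}"
    (is "L2_set ?F _ = L2_set ?G _")
proof -
  have FG: "?F (N - Suc i) = ?G i" if "i < N" for i
    using that by (subst sum.nat_diff_reindex[symmetric])
      (auto intro!: sum.cong simp: of_nat_diff abs_minus_commute)
  have "(\<Sum>i<N. (?F i)\<^sup>2) = (\<Sum>i<N. (?F (N - Suc i))\<^sup>2)"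
    by (rule sum.nat_diff_reindex[symmetric])
  also have "\<dots> = (\<Sum>i<N. (?G i)\<^sup>2)"
    by (intro sum.cong) (auto simp only: FG lessThan_iff)
  finally show ?thesis
    unfolding L2_set_def by simp
qed

section \<open>The effect of banding on a vector\<close>

lemma shifted_mat_mult_vec_index:
  assumes "A \<in> carrier_mat N N" "v \<in> carrier_vec N" "i < N"
  shows "((map_mat complex_of_real A - \<mu> \<cdot>\<^sub>m 1\<^sub>m N) *\<^sub>v v) $ i
    = (\<Sum>j<N. (complex_of_real (A $$ (i, j)) - \<mu> * (if i = j then 1 else 0)) * v $ j)"
  using assms by (auto simp: scalar_prod_def lessThan_atLeast0 intro!: sum.cong)

text \<open>The triangle inequality is used in each entry and then for the 2-norm. The weight
  \<open>w\<close> is left abstract so that decay from either end is an instance.\<close>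

lemma banded_perturbation_bound:
  fixes A :: "real mat" and w :: "nat \<Rightarrow> real"
  assumes A: "A \<in> carrier_mat N N" and v: "v \<in> carrier_vec N" and k: "k > 0"
    and entries: "\<And>i j. i < N \<Longrightarrow> j < N \<Longrightarrow> i \<noteq> j \<Longrightarrow> \<bar>A $$ (i, j)\<bar> \<le> B / \<bar>real i - real j\<bar>"
    and B: "0 \<le> B" and c: "0 \<le> c"
    and decay: "\<And>j. j < N \<Longrightarrow> cmod (v $ j) \<le> c * w j"
  shows "vec_norm2 ((map_mat complex_of_real A - \<mu> \<cdot>\<^sub>m 1\<^sub>m N) *\<^sub>v v)
    \<le> vec_norm2 ((map_mat complex_of_real (banded k A) - \<mu> \<cdot>\<^sub>m 1\<^sub>m N) *\<^sub>v v)
       + B * c * L2_set (\<lambda>i. \<Sum>j<N. if int k \<le> \<bar>int i - int j\<bar> then w j / \<bar>real i - real j\<bar> else 0) {..<N}"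
    (is "vec_norm2 ?x \<le> vec_norm2 ?y + _ * L2_set ?S _")
proof -
  have Bk: "banded k A \<in> carrier_mat N N"
    using A by (simp add: banded_def)
  have dim: "dim_vec ?x = N" "dim_vec ?y = N"
    by simp_all
  have entry: "cmod (?x $ i) \<le> cmod (?y $ i) + B * c * ?S i" if i: "i < N" for i
  proof -
    \<comment> \<open>The shift by \<open>\<mu>\<close> is common to both matrices and cancels,
      leaving only the discarded entries.\<close>
    have "?x $ i - ?y $ i = (\<Sum>j<N. complex_of_real (A $$ (i, j) - banded k A $$ (i, j)) * v $ j)"
      unfolding shifted_mat_mult_vec_index[OF A v i] shifted_mat_mult_vec_index[OF Bk v i]
        sum_subtractf[symmetric]
      by (intro sum.cong) (auto simp: algebra_simps)
    also have "cmod \<dots> \<le> (\<Sum>j<N. \<bar>A $$ (i, j) - banded k A $$ (i, j)\<bar> * cmod (v $ j))"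
      by (rule order_trans[OF norm_sum]) (simp add: norm_mult del: of_real_diff)
    also have "\<dots> \<le> (\<Sum>j<N. B * c * (if int k \<le> \<bar>int i - int j\<bar> then w j / \<bar>real i - real j\<bar> else 0))"
    proof (rule sum_mono)
      fix j
      assume "j \<in> {..<N}"
      then have j: "j < N" by simp
      show "\<bar>A $$ (i, j) - banded k A $$ (i, j)\<bar> * cmod (v $ j)
        \<le> B * c * (if int k \<le> \<bar>int i - int j\<bar> then w j / \<bar>real i - real j\<bar> else 0)"
      \<comment> \<open>Outside the band the difference is the full entry, which is off the diagonal
        because \<open>k > 0\<close>, so the entry bound applies; inside the band it
        vanishes.\<close>
      proof (cases "int k \<le> \<bar>int i - int j\<bar>")
        case True
        then have "i \<noteq> j" using k by auto
        have "\<bar>A $$ (i, j)\<bar> * cmod (v $ j) \<le> (B / \<bar>real i - real j\<bar>) * (c * w j)"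
          using B by (intro mult_mono entries[OF i j \<open>i \<noteq> j\<close>] decay[OF j]) auto
        then show ?thesis
          using True A i j by (simp add: banded_def mult_ac)
      next
        case False
        then show ?thesis
          using A i j by (simp add: banded_def)
      qed
    qed
    also have "\<dots> = B * c * ?S i"
      by (simp add: sum_distrib_left)
    finally show ?thesis
      using norm_triangle_ineq2[of "?x $ i" "?y $ i"] by linarith
  qed
  have "vec_norm2 ?x \<le> L2_set (\<lambda>i. cmod (?y $ i) + B * c * ?S i) {..<N}"
    unfolding vec_norm2_def dim by (intro L2_set_mono entry) (simp_all del: index_mult_mat_vec)
  also have "\<dots> \<le> L2_set (\<lambda>i. cmod (?y $ i)) {..<N} + L2_set (\<lambda>i. B * c * ?S i) {..<N}"
    by (rule L2_set_triangle_ineq)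
  also have "\<dots> = vec_norm2 ?y + B * c * L2_set ?S {..<N}"
    unfolding vec_norm2_def dim using B c by (simp add: L2_set_right_distrib)
  finally show ?thesis .
qed

section \<open>Unit vectors and their normalized decay\<close>

lemma vec_max_bounds_of_unit:
  assumes "vec_norm2 v = 1"
  shows "0 < vec_max v" "vec_max v \<le> 1"
proof -
  let ?A = "(\<lambda>i. cmod (v $ i)) ` {..<dim_vec v}"
  \<comment> \<open>A nonzero entry makes the maximum positive and also shows that the set under
    \<open>Max\<close> is nonempty.\<close>
  have "\<exists>i<dim_vec v. v $ i \<noteq> 0"
  proof (rule ccontr)
    assume "\<not> ?thesis"
    then have "vec_norm2 v = 0"
      unfolding vec_norm2_def by (intro L2_set_eq_0_iff[THEN iffD2]) auto
    then show False using assms by simp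
  qed
  then obtain i where i: "i < dim_vec v" "v $ i \<noteq> 0" by blast
  then have "cmod (v $ i) \<le> vec_max v"
    unfolding vec_max_def by (intro Max_ge) auto
  then show "0 < vec_max v"
    using i by (meson less_le_trans zero_less_norm_iff)
  have "Max ?A \<in> ?A"
    using i by (intro Max_in) auto
  then obtain m where "m < dim_vec v" "vec_max v = cmod (v $ m)"
    unfolding vec_max_def by auto
  then show "vec_max v \<le> 1"
    using member_le_L2_set[of "{..<dim_vec v}" m "\<lambda>i. cmod (v $ i)"] assms
    by (simp add: vec_norm2_def)
qed

text \<open>The quotient is nonnegative, which forces the sign of \<open>C\<close>; the maximum of a
  unit vector is at most 1, so multiplying by it can only shrink the bound.\<close>

lemma decay_unnormalized:
  assumes "vec_norm2 v = 1" and j: "cmod (v $ j) / vec_max v \<le> C * t" and "0 < t"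
  shows "0 \<le> C" "cmod (v $ j) \<le> C * t"
proof -
  note M = vec_max_bounds_of_unit[OF assms(1)]
  have "0 \<le> C * t"
    using M by (intro order_trans[OF _ j]) simp
  then show "0 \<le> C"
    using \<open>0 < t\<close> by (simp add: zero_le_mult_iff)
  have "cmod (v $ j) \<le> C * t * vec_max v"
    using j M by (simp add: divide_simps)
  also have "\<dots> \<le> C * t"
    using M \<open>0 \<le> C * t\<close> by (rule_tac mult_left_le) auto
  finally show "cmod (v $ j) \<le> C * t" .
qed

theorem theorem6p2:
  fixes s \<gamma> \<delta> K \<epsilon>\<^sub>1 :: real and D :: "(real^3) set"
  assumes s: "0 < s" "s < 1"
    and D: "admissible_resonator s D"
    and \<gamma>: "\<gamma> \<noteq> 0"
    and \<delta>: "\<delta> > 0"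
    and K: "\<And>N i j. i < N \<Longrightarrow> j < N \<Longrightarrow> i \<noteq> j \<Longrightarrow>
              \<bar>gauge_capacitance D \<gamma> \<delta> N $$ (i, j)\<bar> \<le> \<delta> * K / \<bar>real i - real j\<bar>"
    and \<epsilon>\<^sub>1: "\<epsilon>\<^sub>1 > 0"
  shows "(\<exists>k::nat. k > 0 \<and> max (1 / real k) (\<Sum>n. 1 / (real (k + n))\<^sup>2) < \<epsilon>\<^sub>1) \<and>
    (\<forall>(k::nat) (N::nat) (\<mu>::complex) (\<epsilon>\<^sub>2::real) (C::real) (\<rho>::real) (v :: complex Matrix.vec).
       k > 0 \<and> max (1 / real k) (\<Sum>n. 1 / (real (k + n))\<^sup>2) < \<epsilon>\<^sub>1 \<and>
       N \<ge> 1 \<and> \<epsilon>\<^sub>2 > 0 \<and> 0 < \<rho> \<and> \<rho> < 1 - \<epsilon>\<^sub>1 \<and>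
       v \<in> carrier_vec N \<and> vec_norm2 v = 1 \<and>
       vec_norm2 ((map_mat complex_of_real (banded k (gauge_capacitance D \<gamma> \<delta> N))
                   - \<mu> \<cdot>\<^sub>m 1\<^sub>m N) *\<^sub>v v) \<le> \<epsilon>\<^sub>2 \<and>
       ((\<forall>j\<in>{1..N}. cmod (v $ (j - 1)) / vec_max v \<le> C * \<rho> ^ (j - 1)) \<or>
        (\<forall>j\<in>{1..N}. cmod (v $ (j - 1)) / vec_max v \<le> C * \<rho> ^ (N - j)))
       \<longrightarrow>
       vec_norm2 ((map_mat complex_of_real (gauge_capacitance D \<gamma> \<delta> N)
                   - \<mu> \<cdot>\<^sub>m 1\<^sub>m N) *\<^sub>v v)
       \<le> \<epsilon>\<^sub>2 + \<delta> * K * C *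
            ((1 - \<epsilon>\<^sub>1) / (1 - \<epsilon>\<^sub>1 - \<rho>) * sqrt \<epsilon>\<^sub>1
             + \<epsilon>\<^sub>1 * \<rho> ^ k * (1 / (1 - \<rho>)) * sqrt (1 / (1 - \<rho>\<^sup>2))))"
proof (intro conjI allI impI, rule exists_small_tail[OF \<epsilon>\<^sub>1], elim conjE)
  fix k N :: nat and \<mu> :: complex and \<epsilon>\<^sub>2 C \<rho> :: real and v :: "complex Matrix.vec"
  let ?T = "\<Sum>n. 1 / (real (k + n))\<^sup>2"
  let ?A = "gauge_capacitance D \<gamma> \<delta> N"
  let ?S = "\<lambda>w. L2_set (\<lambda>i. \<Sum>j<N. if int k \<le> \<bar>int i - int j\<bar>
                    then w j / \<bar>real i - real j\<bar> else 0) {..<N}"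
  let ?R = "(1 - \<epsilon>\<^sub>1) / (1 - \<epsilon>\<^sub>1 - \<rho>) * sqrt \<epsilon>\<^sub>1
             + \<epsilon>\<^sub>1 * \<rho> ^ k * (1 / (1 - \<rho>)) * sqrt (1 / (1 - \<rho>\<^sup>2))"
  assume k: "k > 0" and max: "max (1 / real k) ?T < \<epsilon>\<^sub>1"
    and N: "N \<ge> 1" and \<rho>: "0 < \<rho>" "\<rho> < 1 - \<epsilon>\<^sub>1"
    and v: "v \<in> carrier_vec N" and unit: "vec_norm2 v = 1"
    and pseudo: "vec_norm2 ((map_mat complex_of_real (banded k ?A) - \<mu> \<cdot>\<^sub>m 1\<^sub>m N) *\<^sub>v v) \<le> \<epsilon>\<^sub>2"
    and decay: "(\<forall>j\<in>{1..N}. cmod (v $ (j - 1)) / vec_max v \<le> C * \<rho> ^ (j - 1)) \<or>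
        (\<forall>j\<in>{1..N}. cmod (v $ (j - 1)) / vec_max v \<le> C * \<rho> ^ (N - j))"
  have \<rho>1: "\<rho> < 1" using \<rho> \<epsilon>\<^sub>1 by simp
  \<comment> \<open>The sign is read off from the entry \<open>(0, 1)\<close> of the matrix for two
    resonators, since for \<open>N = 1\<close> the matrix at hand has no off-diagonal entry.\<close>
  have "0 \<le> \<delta> * K"
    using K[of 0 2 1] by simp
  \<comment> \<open>Both decay alternatives become one weight on indices from 0; the exponent
    \<open>N - j\<close> for \<open>j\<close> counted from 1 turns into
    \<open>N - Suc j\<close>.\<close>
  obtain w where w: "w = (\<lambda>j. \<rho> ^ j) \<or> w = (\<lambda>j. \<rho> ^ (N - Suc j))"
    and norm_decay: "\<And>j. j < N \<Longrightarrow> cmod (v $ j) / vec_max v \<le> C * w j"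
  proof -
    have "j < N \<Longrightarrow> Suc j \<in> {1..N}" for j by simp
    then show ?thesis
      using decay that[of "\<lambda>j. \<rho> ^ j"] that[of "\<lambda>j. \<rho> ^ (N - Suc j)"]
      by (metis diff_Suc_1)
  qed
  have w_pos: "0 < w j" for j
    using w \<rho> by auto
  note bounds = decay_unnormalized[OF unit norm_decay w_pos]
  have "0 \<le> C"
    using bounds(1)[of 0] N by simp
  \<comment> \<open>After cross-multiplication this is \<open>1 - \<epsilon>\<^sub>1 - \<rho> \<le>
    (1 - \<epsilon>\<^sub>1) * (1 - \<rho>)\<close>; the two sides differ by
    \<open>\<epsilon>\<^sub>1 * \<rho>\<close>, and \<open>\<rho> < 1 - \<epsilon>\<^sub>1\<close>
    keeps the denominators positive.\<close>
  have "1 / (1 - \<rho>) \<le> (1 - \<epsilon>\<^sub>1) / (1 - \<epsilon>\<^sub>1 - \<rho>)"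
    using \<rho> \<rho>1 \<epsilon>\<^sub>1 by (simp add: divide_simps algebra_simps)
  then have "1 / (1 - \<rho>) * sqrt ?T \<le> (1 - \<epsilon>\<^sub>1) / (1 - \<epsilon>\<^sub>1 - \<rho>) * sqrt \<epsilon>\<^sub>1"
    using \<rho> \<epsilon>\<^sub>1 max inverse_squares_tail_nonneg[of k]
    by (intro mult_mono real_sqrt_le_mono real_sqrt_ge_zero) (auto simp: zero_le_divide_iff)
  moreover have "1 / real k * \<rho> ^ k * (1 / (1 - \<rho>)) * sqrt (1 / (1 - \<rho>\<^sup>2))
      \<le> \<epsilon>\<^sub>1 * \<rho> ^ k * (1 / (1 - \<rho>)) * sqrt (1 / (1 - \<rho>\<^sup>2))"
    using \<rho> \<rho>1 \<epsilon>\<^sub>1 max by (intro mult_right_mono) (auto simp: power_le_one)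
  moreover have "?S w = ?S (\<lambda>j. \<rho> ^ j)"
    using w L2_set_far_field_reverse[where N = N and k = k and \<rho> = \<rho>] by auto
  ultimately have S: "?S w \<le> ?R"
    using L2_set_far_field_le[OF k \<rho>(1) \<rho>1, where N = N] by linarith
  have "?A \<in> carrier_mat N N"
    by (simp add: gauge_capacitance_def)
  from banded_perturbation_bound[OF this v k K \<open>0 \<le> \<delta> * K\<close> \<open>0 \<le> C\<close> bounds(2), of \<mu>]
  have "vec_norm2 ((map_mat complex_of_real ?A - \<mu> \<cdot>\<^sub>m 1\<^sub>m N) *\<^sub>v v) \<le> \<epsilon>\<^sub>2 + \<delta> * K * C * ?S w"
    using pseudo by linarith
  also have "\<dots> \<le> \<epsilon>\<^sub>2 + \<delta> * K * C * ?R"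
    using S \<open>0 \<le> \<delta> * K\<close> \<open>0 \<le> C\<close> by (intro add_left_mono mult_left_mono) auto
  finally show "vec_norm2 ((map_mat complex_of_real ?A - \<mu> \<cdot>\<^sub>m 1\<^sub>m N) *\<^sub>v v)
      \<le> \<epsilon>\<^sub>2 + \<delta> * K * C * ?R" .
qed

end
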